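(* For every $n\geq 5$, the cycle graph $C_n$ on $n$ vertices is not $12$-representable.
   Context: All graphs are simple and finite. For a word $w$ over the positive integers, $A(w)$ is the set of letters occurring in $w$; for $B\subseteq A(w)$, $w_B$ is the word obtained from $w$ by deleting all letters not in $B$. A word $w=w_1\cdots w_m$ has a $12$-match if $w_i<w_{i+1}$ for some $i$. A labeled graph $G=([n],E)$, with $[n]=\{1,\ldots,n\}$, is $12$-representable if there is a word $w\in[n]^*$ with $A(w)=[n]$ such that for all distinct $x,y\in[n]$: $xy\in E$ if and only if $w_{\{x,y\}}$ has no $12$-match. An unlabeled graph is $12$-representable if some labeling of its vertices by $[n]$ (where $n$ is the number of vertices) gives a $12$-representable labeled graph. *)

theory Defs
  imports "Graph_Theory.Pair_Digraph"
begin

text \<open>Finite simple graphs are the \<open>pair_graph\<close>s of the \<open>Graph_Theory\<close> entry: finite loopfree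
  digraphs whose arc relation is symmetric, so an edge \<open>xy\<close> is the pair of arcs \<open>(x, y)\<close>, \<open>(y, x)\<close>.\<close>

definition restrict_word :: "nat list \<Rightarrow> nat set \<Rightarrow> nat list" where
  "restrict_word w B = filter (\<lambda>a. a \<in> B) w"

definition has_12_match :: "nat list \<Rightarrow> bool" where
  "has_12_match w \<longleftrightarrow> (\<exists>i. Suc i < length w \<and> w ! i < w ! Suc i)"

definition labeled_12_representable :: "nat pair_pre_digraph \<Rightarrow> bool" where
  "labeled_12_representable G \<longleftrightarrow>
     (\<exists>n. pverts G = {1..n} \<and>
       (\<exists>w. set w = {1..n} \<and>
         (\<forall>x\<in>{1..n}. \<forall>y\<in>{1..n}. x \<noteq> y \<longrightarrow>
           ((x, y) \<in> parcs G \<longleftrightarrow> \<not> has_12_match (restrict_word w {x, y})))))"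

definition relabel :: "('a \<Rightarrow> 'b) \<Rightarrow> 'a pair_pre_digraph \<Rightarrow> 'b pair_pre_digraph" where
  "relabel f G = \<lparr>pverts = f ` pverts G, parcs = map_prod f f ` parcs G\<rparr>"

definition representable_12 :: "'a pair_pre_digraph \<Rightarrow> bool" where
  "representable_12 G \<longleftrightarrow>
     (\<exists>f. bij_betw f (pverts G) {1..card (pverts G)} \<and> labeled_12_representable (relabel f G))"

text \<open>The cycle on the vertices \<open>0, \<dots>, n - 1\<close>. It is a simple graph only for \<open>n \<ge> 3\<close>.\<close>

definition cycle_graph :: "nat \<Rightarrow> nat pair_pre_digraph" where
  "cycle_graph n = \<lparr>pverts = {..<n},
     parcs = {(i, j). i < n \<and> j < n \<and> (j = Suc i mod n \<or> i = Suc j mod n)}\<rparr>"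

lemma pair_graph_cycle_graph:
  assumes "n \<ge> 3"
  shows "pair_graph (cycle_graph n)"
proof -
  have "finite {(i, j). i < n \<and> j < n \<and> (j = Suc i mod n \<or> i = Suc j mod n)}"
    by (rule finite_subset[of _ "{..<n} \<times> {..<n}"]) auto
  moreover have "Suc i mod n \<noteq> i" if "i < n" for i
    using assms that by (cases "Suc i = n") auto
  ultimately show ?thesis
    unfolding cycle_graph_def by unfold_locales (force simp: symmetric_def arcs_ends_conv intro!: symI)+
qed

end

theory Submission
  imports Defs
begin

text \<open>For \<open>x < y\<close>, the labels \<open>x\<close> and \<open>y\<close> are adjacent iff no \<open>x\<close> stands before a \<open>y\<close> in the word,
  that is, iff all copies of \<open>y\<close> stand before all copies of \<open>x\<close>. Two consequences for a cycle of
  length at least 5 exclude each other.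

  First, if \<open>x < y < z\<close> and \<open>xy\<close>, \<open>yz\<close> are edges, then so is \<open>xz\<close>
  (\<open>no_occurs_before_trans\<close>). Vertices at distance 2 on the cycle are not adjacent, so the labels
  go up and down alternately along the cycle.

  Second, if \<open>ab\<close> and \<open>a'b'\<close> are edges with \<open>a < b\<close> and \<open>a' < b'\<close>, and neither \<open>ab'\<close> nor \<open>a'b\<close> is
  an edge, then \<open>b' \<le> a\<close> or \<open>b \<le> a'\<close>: one of the two edges lies below the other
  (\<open>edges_separated\<close>).

  Now let \<open>v\<close> be the local maximum with the smallest label, and let \<open>b, a, v, a', b'\<close> be consecutive
  vertices. Then \<open>b\<close> and \<open>b'\<close> are local maxima too. In a cycle of length at least 5, vertices
  at distance 3 are not adjacent, so the edges \<open>ab\<close> and \<open>a'b'\<close> are as above. Hence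
  \<open>b' \<le> a < v\<close> or \<open>b \<le> a' < v\<close>, against the choice of \<open>v\<close> (\<open>no_cyclic_zigzag\<close>).\<close>

definition occurs_before :: "'a list \<Rightarrow> 'a \<Rightarrow> 'a \<Rightarrow> bool" where
  "occurs_before w x y \<longleftrightarrow> (\<exists>i j. i < j \<and> j < length w \<and> w ! i = x \<and> w ! j = y)"

text \<open>Consecutive letters suffice because \<open>\<ge>\<close> is transitive.\<close>

lemma no_12_match_iff_sorted_wrt: "\<not> has_12_match w \<longleftrightarrow> sorted_wrt (\<ge>) w"
proof -
  have "transp ((\<ge>) :: nat \<Rightarrow> nat \<Rightarrow> bool)"
    by (auto intro: transpI)
  then have "sorted_wrt (\<ge>) w \<longleftrightarrow> (\<forall>i. Suc i < length w \<longrightarrow> w ! i \<ge> w ! Suc i)"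
    by (rule sorted_wrt_iff_nth_Suc_transp)
  then show ?thesis
    unfolding has_12_match_def by (meson not_less)
qed

lemma sorted_wrt_filter_iff:
  "sorted_wrt R (filter P w) \<longleftrightarrow> sorted_wrt (\<lambda>a b. P a \<longrightarrow> P b \<longrightarrow> R a b) w"
  by (induction w) auto

lemma no_12_match_restrict_iff:
  assumes "x < y"
  shows "\<not> has_12_match (restrict_word w {x, y}) \<longleftrightarrow> \<not> occurs_before w x y"
proof -
  have "(a \<in> {x, y} \<longrightarrow> b \<in> {x, y} \<longrightarrow> a \<ge> b) \<longleftrightarrow> \<not> (a = x \<and> b = y)" for a b
    using assms by auto
  then have "\<not> has_12_match (restrict_word w {x, y}) \<longleftrightarrow> sorted_wrt (\<lambda>a b. \<not> (a = x \<and> b = y)) w"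
    unfolding no_12_match_iff_sorted_wrt restrict_word_def sorted_wrt_filter_iff by presburger
  then show ?thesis
    unfolding occurs_before_def sorted_wrt_iff_nth_less by blast
qed

text \<open>Any copy of \<open>y\<close> separates the copies of \<open>z\<close> on its left from the copies of \<open>x\<close> on its right.\<close>

lemma no_occurs_before_trans:
  assumes "\<not> occurs_before w x y" "\<not> occurs_before w y z"
    and "y \<in> set w" "x \<noteq> y" "y \<noteq> z"
  shows "\<not> occurs_before w x z"
proof
  assume "occurs_before w x z"
  then obtain i j where ij: "i < j" "j < length w" "w ! i = x" "w ! j = z"
    unfolding occurs_before_def by blast
  obtain k where k: "k < length w" "w ! k = y"
    using assms(3) by (auto simp: in_set_conv_nth)
  have "\<not> i < k" "\<not> k < j"
    using assms(1,2) ij k unfolding occurs_before_def by blast+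
  with ij k assms(4,5) show False
    by auto
qed

text \<open>If neither label interval lies below the other, then \<open>a < b'\<close> and \<open>a' < b\<close>, so the two
  non-edges give an \<open>a\<close> before a \<open>b'\<close> and an \<open>a'\<close> before a \<open>b\<close>. The two edges put this \<open>b'\<close> before this
  \<open>a'\<close> and this \<open>b\<close> before this \<open>a\<close>, and the four positions form a cycle.\<close>

lemma edges_separated:
  fixes a b a' b' :: "'a :: linorder"
  assumes "\<not> occurs_before w a b" "\<not> occurs_before w a' b'" "a < b" "a' < b'"
    and "a < b' \<Longrightarrow> occurs_before w a b'" "a' < b \<Longrightarrow> occurs_before w a' b"
  shows "b' \<le> a \<or> b \<le> a'"
proof (rule ccontr)
  assume "\<not> ?thesis"
  then have "occurs_before w a b'" "occurs_before w a' b"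
    using assms(5,6) by auto
  then obtain i j i' j' where
    pos: "i < j" "j < length w" "w ! i = a" "w ! j = b'"
      "i' < j'" "j' < length w" "w ! i' = a'" "w ! j' = b"
    unfolding occurs_before_def by blast
  have "\<not> i < j'" "\<not> i' < j"
    using assms(1,2) pos unfolding occurs_before_def by blast+
  with pos show False
    by auto
qed

text \<open>The hypothesis on the pairs \<open>v j\<close>, \<open>v (j + 3)\<close> and \<open>v (j + 4)\<close>, \<open>v (j + 1)\<close> is what
  \<open>edges_separated\<close> gives for the first and the last edge of a path of five vertices.\<close>

lemma no_cyclic_zigzag:
  fixes v :: "nat \<Rightarrow> 'a :: wellorder"
  assumes periodic: "\<And>i. v (i + n) = v i" and "n \<ge> 2"
    and zigzag: "\<And>i. v i < v (i + 1) \<longleftrightarrow> v (i + 2) < v (i + 1)"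
    and neq: "\<And>i. v i \<noteq> v (i + 1)"
    and separated: "\<And>j. v (j + 1) < v j \<Longrightarrow> v (j + 3) < v (j + 4) \<Longrightarrow>
      v (j + 4) \<le> v (j + 1) \<or> v j \<le> v (j + 3)"
  shows False
proof -
  \<comment> \<open>As the labels zigzag, a descent starts exactly at a local maximum.\<close>
  define descent where "descent i \<longleftrightarrow> v (i + 1) < v i" for i
  have alternate: "descent (Suc i) \<longleftrightarrow> \<not> descent i" for i
    using zigzag[of i] neq[of i] unfolding descent_def by (auto simp: not_less le_less)
  define m where "m = (LEAST x. \<exists>i. descent i \<and> v i = x)"
  have least: "m \<le> v i" if "descent i" for i
    unfolding m_def using that by (blast intro: Least_le)
  have "\<exists>x i. descent i \<and> v i = x"
    using alternate by blast
  then have "\<exists>i. descent i \<and> v i = m"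
    unfolding m_def by (rule LeastI_ex)
  then obtain k where k: "descent k" "v k = m"
    by blast
  \<comment> \<open>Going once around the cycle makes room for two vertices before the minimal one.\<close>
  define j where "j = k + n - 2"
  have jk: "j + 2 = k + n"
    unfolding j_def using \<open>n \<ge> 2\<close> by simp
  have m: "v (j + 2) = m"
    unfolding jk using periodic k(2) by simp
  have "descent (j + 2)"
    unfolding jk using periodic[of k] periodic[of "k + 1"] k(1)
    by (simp add: descent_def add.commute add.left_commute)
  then have des: "descent j" "\<not> descent (j + 1)" "descent (j + 2)" "\<not> descent (j + 3)" "descent (j + 4)"
    using alternate by (simp_all add: numeral_eq_Suc)
  have lt: "v (j + 1) < v j" "v (j + 1) < m" "v (j + 3) < m" "v (j + 3) < v (j + 4)"
    using des neq[of "j + 1"] neq[of "j + 3"] m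
    unfolding descent_def by (auto simp: numeral_eq_Suc not_less le_less)
  have "v (j + 4) < m \<or> v j < m"
    using separated[OF lt(1,4)] lt(2,3) by auto
  then show False
    using least des(1,5) by (meson not_less)
qed

lemma cycle_graph_arc_mod_iff:
  assumes "n > 0"
  shows "(i mod n, j mod n) \<in> parcs (cycle_graph n) \<longleftrightarrow>
    Suc i mod n = j mod n \<or> Suc j mod n = i mod n"
  using assms unfolding cycle_graph_def by (auto simp: mod_Suc_eq)

lemma add_mod_neq:
  fixes i a b n :: nat
  assumes "a < b" "b < a + n"
  shows "(i + a) mod n \<noteq> (i + b) mod n"
proof
  assume "(i + a) mod n = (i + b) mod n"
  then have "n dvd (i + b) - (i + a)"
    using assms by (metis mod_eq_dvd_iff_nat nat_add_left_cancel_le less_imp_le)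
  then have "n dvd b - a"
    by simp
  moreover have "0 < b - a" "b - a < n"
    using assms by auto
  ultimately show False
    by (auto dest: dvd_imp_le)
qed

theorem theorem8:
  fixes n :: nat
  assumes "n \<ge> 5"
  shows "\<not> representable_12 (cycle_graph n)"
proof
  assume "representable_12 (cycle_graph n)"
  moreover have verts: "pverts (cycle_graph n) = {..<n}"
    by (simp add: cycle_graph_def)
  ultimately obtain f where f: "bij_betw f {..<n} {1..n}"
    and lab: "labeled_12_representable (relabel f (cycle_graph n))"
    unfolding representable_12_def by auto
  obtain N w where N: "f ` {..<n} = {1..N}" and w: "set w = {1..N}"
    and repr: "\<forall>x\<in>{1..N}. \<forall>y\<in>{1..N}. x \<noteq> y \<longrightarrow>
      ((x, y) \<in> map_prod f f ` parcs (cycle_graph n) \<longleftrightarrow> \<not> has_12_match (restrict_word w {x, y}))"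
    using lab unfolding labeled_12_representable_def relabel_def pair_pre_digraph.simps verts
    by blast
  \<comment> \<open>The labels along the cycle, read off periodically.\<close>
  define v where "v i = f (i mod n)" for i
  have inj: "inj_on f {..<n}"
    using f by (rule bij_betw_imp_inj_on)
  have mod_less: "i mod n < n" for i
    using assms by simp
  have v_eq: "v i = v j \<longleftrightarrow> i mod n = j mod n" for i j
    unfolding v_def using inj mod_less by (auto simp: inj_on_eq_iff)
  have v_in: "v i \<in> {1..N}" for i
    unfolding v_def N[symmetric] using mod_less by blast
  have arc: "(v i, v j) \<in> map_prod f f ` parcs (cycle_graph n) \<longleftrightarrow>
      Suc i mod n = j mod n \<or> Suc j mod n = i mod n" for i j
  proof -
    have "inj_on (map_prod f f) ({..<n} \<times> {..<n})"
      using inj by (simp add: map_prod_inj_on)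
    moreover have "(i mod n, j mod n) \<in> {..<n} \<times> {..<n}"
      using mod_less by simp
    moreover have "parcs (cycle_graph n) \<subseteq> {..<n} \<times> {..<n}"
      by (auto simp: cycle_graph_def)
    ultimately have "map_prod f f (i mod n, j mod n) \<in> map_prod f f ` parcs (cycle_graph n) \<longleftrightarrow>
        (i mod n, j mod n) \<in> parcs (cycle_graph n)"
      by (rule inj_on_image_mem_iff)
    then show ?thesis
      using cycle_graph_arc_mod_iff assms by (simp add: v_def)
  qed
  have edge_iff: "\<not> occurs_before w (v i) (v j) \<longleftrightarrow>
      Suc i mod n = j mod n \<or> Suc j mod n = i mod n" if "v i < v j" for i j
    using repr[rule_format, OF v_in v_in, of i j] arc[of i j] no_12_match_restrict_iff[OF that] that by auto
  have neq1: "v i \<noteq> v (i + 1)" for i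
    using add_mod_neq[of 0 1 n i] assms by (simp add: v_eq)
  have edge1: "\<not> occurs_before w (v i) (v (i + 1))" if "v i < v (i + 1)" for i
    using edge_iff[OF that] by simp
  have edge1': "\<not> occurs_before w (v (i + 1)) (v i)" if "v (i + 1) < v i" for i
    using edge_iff[OF that] by simp
  have non2: "Suc i mod n \<noteq> (i + 2) mod n" "Suc (i + 2) mod n \<noteq> i mod n" for i
    using add_mod_neq[of 1 2 n i] add_mod_neq[of 0 3 n i] assms by (simp_all add: numeral_eq_Suc)
  have non3: "Suc i mod n \<noteq> (i + 3) mod n" "Suc (i + 3) mod n \<noteq> i mod n" for i
    using add_mod_neq[of 1 3 n i] add_mod_neq[of 0 4 n i] assms by (simp_all add: numeral_eq_Suc)
  have nonadj: "occurs_before w (v i) (v j)"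
    if "v i < v j" "j = i + 2 \<or> i = j + 2 \<or> j = i + 3 \<or> i = j + 3" for i j
    using edge_iff[OF that(1)] that(2) non2[of i] non2[of j] non3[of i] non3[of j] by metis
  have zigzag: "v i < v (i + 1) \<longleftrightarrow> v (i + 2) < v (i + 1)" for i
  proof -
    have next_edges: "v (i + 1) < v (i + 2) \<Longrightarrow> \<not> occurs_before w (v (i + 1)) (v (i + 2))"
      "v (i + 2) < v (i + 1) \<Longrightarrow> \<not> occurs_before w (v (i + 2)) (v (i + 1))"
      using edge1[of "i + 1"] edge1'[of "i + 1"] by simp_all
    have occurs: "v (i + 1) \<in> set w"
      using w v_in by blast
    have "\<not> (v i < v (i + 1) \<and> v (i + 1) < v (i + 2))"
      using no_occurs_before_trans[OF edge1 next_edges(1) occurs] nonadj[of i "i + 2"]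
      by (metis less_irrefl less_trans)
    moreover have "\<not> (v (i + 2) < v (i + 1) \<and> v (i + 1) < v i)"
      using no_occurs_before_trans[OF next_edges(2) edge1' occurs] nonadj[of "i + 2" i]
      by (metis less_irrefl less_trans)
    moreover have "v (i + 1) \<noteq> v (i + 2)"
      using neq1[of "i + 1"] by simp
    ultimately show ?thesis
      using neq1[of i] by (meson linorder_neqE)
  qed
  have separated: "v (j + 4) \<le> v (j + 1) \<or> v j \<le> v (j + 3)"
    if "v (j + 1) < v j" "v (j + 3) < v (j + 4)" for j
  proof (rule edges_separated)
    show "\<not> occurs_before w (v (j + 3)) (v (j + 4))"
      using edge1[of "j + 3"] that(2) by (simp add: add.commute)
  qed (use that edge1' nonadj[of "j + 1" "j + 4"] nonadj[of "j + 3" j] in auto)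
  have periodic: "v (i + n) = v i" for i
    by (simp add: v_def)
  show False
    by (rule no_cyclic_zigzag[OF periodic _ zigzag neq1 separated]) (use assms in auto)
qed

end
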